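(* In four dimensions, let $\boldsymbol v^0(\cdot,\boldsymbol\xi)$, $\boldsymbol\xi\in\mathbb R^4$, be the quadruple-periodic field of the context and let $\mathcal V_1^0$ be the $x_1$-independent part of $g_1^0$. Then $\mathcal V_1^0$ vanishes identically in $\boldsymbol x$ precisely when $\boldsymbol\xi$ lies in the set $$\boldsymbol\xi(\theta,a,\ell_1,\ell_2,\ell_3)=\left(\theta,\ \theta+a+\ell_1\pi,\ \theta+\tfrac{\pi}{2}+\ell_2\pi,\ \theta+a+\ell_3\pi\right),\qquad \theta,a\in\mathbb R,\ \ell_1,\ell_2,\ell_3\in\mathbb Z;$$ equivalently, writing $a=\xi_2-\xi_1$, $b=\xi_3-\xi_2$, $c=\xi_4-\xi_3$, precisely when $b\equiv\tfrac{\pi}{2}-a$ and $c\equiv a-\tfrac{\pi}{2}$ modulo $\pi$. On this set, changing $\theta$ to $\theta+\delta$ translates the field, $\boldsymbol v^0(\boldsymbol x)\mapsto\boldsymbol v^0(\boldsymbol x+\tfrac{\delta}{\alpha}(1,1,1,1))$, and the integers multiply $\boldsymbol v^0$ by $(-1)^{\ell_1+\ell_2+\ell_3}$, so that, up to translation and sign of $\boldsymbol v^0$, the field depends only on $a$.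
   Context: With $\alpha>0$, $v_r>0$, $$\frac{v_1^0}{v_r}=\sin(\alpha x_1+\xi_1)\cos(\alpha x_2+\xi_2)\sin(\alpha x_3+\xi_3)\cos(\alpha x_4+\xi_4)-\sin(\alpha x_1+\xi_2)\sin(\alpha x_2+\xi_3)\cos(\alpha x_3+\xi_4)\cos(\alpha x_4+\xi_1),$$ and $v_i^0$ is obtained from $v_1^0$ by the cyclic coordinate permutation $x_j\mapsto x_{i+j-1}$ (indices modulo 4, in $\{1,2,3,4\}$) with the same $\boldsymbol\xi$. The convective field is $g_i^0=\sum_{j=1}^4v_j^0\,\partial v_i^0/\partial x_j$; $\mathcal V_1^0$ is the sum of all Fourier modes of $g_1^0$ whose wavevector has $k_1=0$ (equivalently, the average of $g_1^0$ over $x_1\in[0,2\pi/\alpha]$). *)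

theory Defs
  imports "HOL-Analysis.Analysis" "HOL-Library.Real_Mod"
begin

text \<open>
  Indices live in the numeral type \<^typ>\<open>4\<close>, i.e. the integers modulo 4, in which
  \<open>4 = 0\<close>; so \<open>x $ 1, x $ 2, x $ 3, x $ 4\<close> are the four coordinates and
  \<open>i + j - 1\<close> is computed modulo 4.
\<close>

definition v1 :: "real \<Rightarrow> real \<Rightarrow> real^4 \<Rightarrow> real^4 \<Rightarrow> real" where
  "v1 \<alpha> v\<^sub>r \<xi> x = v\<^sub>r *
     (sin (\<alpha> * x$1 + \<xi>$1) * cos (\<alpha> * x$2 + \<xi>$2) * sin (\<alpha> * x$3 + \<xi>$3) * cos (\<alpha> * x$4 + \<xi>$4)
    - sin (\<alpha> * x$1 + \<xi>$2) * sin (\<alpha> * x$2 + \<xi>$3) * cos (\<alpha> * x$3 + \<xi>$4) * cos (\<alpha> * x$4 + \<xi>$1))"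

definition vfield :: "real \<Rightarrow> real \<Rightarrow> real^4 \<Rightarrow> real^4 \<Rightarrow> real^4" where
  "vfield \<alpha> v\<^sub>r \<xi> x = (\<chi> i. v1 \<alpha> v\<^sub>r \<xi> (\<chi> j. x $ (i + j - 1)))"

definition partial :: "4 \<Rightarrow> (real^4 \<Rightarrow> real) \<Rightarrow> real^4 \<Rightarrow> real" where
  "partial j f x = deriv (\<lambda>t. f (x + t *\<^sub>R axis j 1)) 0"

definition conv_field :: "real \<Rightarrow> real \<Rightarrow> real^4 \<Rightarrow> real^4 \<Rightarrow> real^4" where
  "conv_field \<alpha> v\<^sub>r \<xi> x =
     (\<chi> i. \<Sum>j\<in>UNIV. vfield \<alpha> v\<^sub>r \<xi> x $ j * partial j (\<lambda>y. vfield \<alpha> v\<^sub>r \<xi> y $ i) x)"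

text \<open>
  The \<open>x\<^sub>1\<close>-independent part of the first component of the convective field (its Fourier modes
  with \<open>k\<^sub>1 = 0\<close>), as the average over one period in \<open>x\<^sub>1\<close>.
\<close>

definition V1 :: "real \<Rightarrow> real \<Rightarrow> real^4 \<Rightarrow> real^4 \<Rightarrow> real" where
  "V1 \<alpha> v\<^sub>r \<xi> x = (\<alpha> / (2 * pi)) *
     integral {0..2 * pi / \<alpha>} (\<lambda>s. conv_field \<alpha> v\<^sub>r \<xi> (\<chi> j. if j = 1 then s else x $ j) $ 1)"

definition xi_family :: "real \<Rightarrow> real \<Rightarrow> int \<Rightarrow> int \<Rightarrow> int \<Rightarrow> real^4" where
  "xi_family \<theta> a l\<^sub>1 l\<^sub>2 l\<^sub>3 =
     vector [\<theta>, \<theta> + a + of_int l\<^sub>1 * pi, \<theta> + pi / 2 + of_int l\<^sub>2 * pi, \<theta> + a + of_int l\<^sub>3 * pi]"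

end

theory Submission
  imports Defs
begin

text \<open>
  Write \<open>y, z, w\<close> for \<open>\<alpha> x\<^sub>2, \<alpha> x\<^sub>3, \<alpha> x\<^sub>4\<close>. Every product
  \<open>v\<^sub>j \<partial>\<^sub>j v\<^sub>1\<close> is quadratic in the sines and cosines of \<open>\<alpha> x\<^sub>1\<close>, so averaging over
  \<open>x\<^sub>1\<close> replaces \<open>sin (\<alpha> x\<^sub>1 + p) cos (\<alpha> x\<^sub>1 + q)\<close> by \<open>sin (p - q) / 2\<close> and
  similarly for two sines. The term \<open>j = 1\<close> is an \<open>x\<^sub>1\<close>-derivative and drops out. What remains is
  \<open>\<alpha> v\<^sub>r\<^sup>2 / 2\<close> times a trigonometric polynomial of ten terms in \<open>y, z, w\<close>
  (\<open>mean_profile\<close>, lemma \<open>V1_eq\<close>), and the question is when this polynomial is zero.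

  Both descriptions of the exceptional set amount to the pair of equations
  \<open>cos (\<xi>\<^sub>3 - \<xi>\<^sub>1) = 0\<close> and \<open>sin (\<xi>\<^sub>4 - \<xi>\<^sub>2) = 0\<close>
  (lemmas \<open>in_xi_family_iff\<close> and \<open>phase_congruences_iff\<close>).

  Sufficiency: shifting a phase by \<open>\<pi>\<close> only changes the sign of the velocity, which acts like a
  sign of \<open>v\<^sub>r\<close> and disappears in \<open>v\<^sub>r\<^sup>2\<close>; so one may take
  \<open>\<xi>\<^sub>3 = \<xi>\<^sub>1 + \<pi>/2\<close> and \<open>\<xi>\<^sub>4 = \<xi>\<^sub>2\<close>. Then the ten terms vanish or cancel in
  pairs (\<open>mean_profile_eq_0\<close>).

  Necessity: only the coefficients of the modes with wavevectors \<open>\<plusminus>(0,2,-2,0)\<close> and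
  \<open>\<plusminus>(0,0,2,-2)\<close>, in units of \<open>\<alpha>\<close>, are needed. The polynomial involves only the frequencies \<open>-2, 0, 2\<close> in each of
  \<open>y, z, w\<close>, so the sum or the difference of its values at arguments half a period
  \<open>\<pi>/2\<close> apart isolates the frequency \<open>0\<close> or \<open>\<plusminus>2\<close> in a variable; this leaves three
  products in two variables (\<open>mean_profile_modes_yz\<close> and \<open>mean_profile_modes_zw\<close>), and evaluating
  these at \<open>0\<close> and \<open>\<pi>/4\<close> separates \<open>(2,-2)\<close> from \<open>(2,2)\<close>. With
  \<open>n = \<xi>\<^sub>2 - \<xi>\<^sub>1 + \<xi>\<^sub>4 - \<xi>\<^sub>3\<close>,
  \<open>m = \<xi>\<^sub>2 - \<xi>\<^sub>1 - \<xi>\<^sub>4 + \<xi>\<^sub>3\<close> and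
  \<open>r = \<xi>\<^sub>3 + \<xi>\<^sub>4 - \<xi>\<^sub>1 - \<xi>\<^sub>2\<close> the vanishing of these coefficients is
  \<open>cos r cos n = 0\<close>, \<open>1 + cos n cos m = sin r sin m\<close>, \<open>cos m (sin n + sin r) = 0\<close>, which forces
  \<open>cos m = 0\<close> and \<open>sin r sin m = 1\<close>, so \<open>cos (r + m) = -1\<close> and \<open>cos (r - m) = 1\<close>; since \<open>r + m = 2 (\<xi>\<^sub>3 - \<xi>\<^sub>1)\<close> and
  \<open>r - m = 2 (\<xi>\<^sub>4 - \<xi>\<^sub>2)\<close>, that is the required pair of equations (\<open>mode_equations\<close>).
\<close>

section \<open>The field, its derivatives and the average over one coordinate\<close>

lemma numerals_mod_4: "(5::4) = 1" "(6::4) = 2" "(7::4) = 3" "(0::4) = 4"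
  by simp_all

lemma vfield_nth:
  shows "vfield \<alpha> v \<xi> x $ 1 = v *
     (sin (\<alpha> * x$1 + \<xi>$1) * cos (\<alpha> * x$2 + \<xi>$2) * sin (\<alpha> * x$3 + \<xi>$3) * cos (\<alpha> * x$4 + \<xi>$4)
    - sin (\<alpha> * x$1 + \<xi>$2) * sin (\<alpha> * x$2 + \<xi>$3) * cos (\<alpha> * x$3 + \<xi>$4) * cos (\<alpha> * x$4 + \<xi>$1))"
  and "vfield \<alpha> v \<xi> x $ 2 = v *
     (sin (\<alpha> * x$2 + \<xi>$1) * cos (\<alpha> * x$3 + \<xi>$2) * sin (\<alpha> * x$4 + \<xi>$3) * cos (\<alpha> * x$1 + \<xi>$4)
    - sin (\<alpha> * x$2 + \<xi>$2) * sin (\<alpha> * x$3 + \<xi>$3) * cos (\<alpha> * x$4 + \<xi>$4) * cos (\<alpha> * x$1 + \<xi>$1))"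
  and "vfield \<alpha> v \<xi> x $ 3 = v *
     (sin (\<alpha> * x$3 + \<xi>$1) * cos (\<alpha> * x$4 + \<xi>$2) * sin (\<alpha> * x$1 + \<xi>$3) * cos (\<alpha> * x$2 + \<xi>$4)
    - sin (\<alpha> * x$3 + \<xi>$2) * sin (\<alpha> * x$4 + \<xi>$3) * cos (\<alpha> * x$1 + \<xi>$4) * cos (\<alpha> * x$2 + \<xi>$1))"
  and "vfield \<alpha> v \<xi> x $ 4 = v *
     (sin (\<alpha> * x$4 + \<xi>$1) * cos (\<alpha> * x$1 + \<xi>$2) * sin (\<alpha> * x$2 + \<xi>$3) * cos (\<alpha> * x$3 + \<xi>$4)
    - sin (\<alpha> * x$4 + \<xi>$2) * sin (\<alpha> * x$1 + \<xi>$3) * cos (\<alpha> * x$2 + \<xi>$4) * cos (\<alpha> * x$3 + \<xi>$1))"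
  by (simp_all add: vfield_def v1_def numerals_mod_4)

lemma partial_vfield_1:
  shows "partial 1 (\<lambda>y. vfield \<alpha> v \<xi> y $ 1) x = v * \<alpha> *
     (cos (\<alpha> * x$1 + \<xi>$1) * cos (\<alpha> * x$2 + \<xi>$2) * sin (\<alpha> * x$3 + \<xi>$3) * cos (\<alpha> * x$4 + \<xi>$4)
    - cos (\<alpha> * x$1 + \<xi>$2) * sin (\<alpha> * x$2 + \<xi>$3) * cos (\<alpha> * x$3 + \<xi>$4) * cos (\<alpha> * x$4 + \<xi>$1))"
  and "partial 2 (\<lambda>y. vfield \<alpha> v \<xi> y $ 1) x = v * \<alpha> *
     (- sin (\<alpha> * x$1 + \<xi>$1) * sin (\<alpha> * x$2 + \<xi>$2) * sin (\<alpha> * x$3 + \<xi>$3) * cos (\<alpha> * x$4 + \<xi>$4)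
    - sin (\<alpha> * x$1 + \<xi>$2) * cos (\<alpha> * x$2 + \<xi>$3) * cos (\<alpha> * x$3 + \<xi>$4) * cos (\<alpha> * x$4 + \<xi>$1))"
  and "partial 3 (\<lambda>y. vfield \<alpha> v \<xi> y $ 1) x = v * \<alpha> *
     (sin (\<alpha> * x$1 + \<xi>$1) * cos (\<alpha> * x$2 + \<xi>$2) * cos (\<alpha> * x$3 + \<xi>$3) * cos (\<alpha> * x$4 + \<xi>$4)
    + sin (\<alpha> * x$1 + \<xi>$2) * sin (\<alpha> * x$2 + \<xi>$3) * sin (\<alpha> * x$3 + \<xi>$4) * cos (\<alpha> * x$4 + \<xi>$1))"
  and "partial 4 (\<lambda>y. vfield \<alpha> v \<xi> y $ 1) x = v * \<alpha> *
     (- sin (\<alpha> * x$1 + \<xi>$1) * cos (\<alpha> * x$2 + \<xi>$2) * sin (\<alpha> * x$3 + \<xi>$3) * sin (\<alpha> * x$4 + \<xi>$4)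
    + sin (\<alpha> * x$1 + \<xi>$2) * sin (\<alpha> * x$2 + \<xi>$3) * cos (\<alpha> * x$3 + \<xi>$4) * sin (\<alpha> * x$4 + \<xi>$1))"
  unfolding partial_def vfield_nth
  by ((rule DERIV_imp_deriv, auto intro!: derivative_eq_intros simp: axis_def algebra_simps)[1])+

lemma period_integral_sin_cos:
  assumes "\<alpha> > 0"
  shows "((\<lambda>s. sin (\<alpha> * s + p) * cos (\<alpha> * s + q)) has_integral (pi / \<alpha> * sin (p - q)))
    {0..2 * pi / \<alpha>}"
proof -
  define F where "F s = sin (p - q) * s / 2 - cos (2 * \<alpha> * s + (p + q)) / (4 * \<alpha>)" for s
  have "((\<lambda>s. sin (\<alpha> * s + p) * cos (\<alpha> * s + q)) has_integral (F (2 * pi / \<alpha>) - F 0)) {0..2 * pi / \<alpha>}"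
  proof (rule fundamental_theorem_of_calculus)
    fix s
    have "sin (2 * \<alpha> * s + (p + q))
        = sin (\<alpha> * s + p) * cos (\<alpha> * s + q) + cos (\<alpha> * s + p) * sin (\<alpha> * s + q)"
      using sin_add[of "\<alpha> * s + p" "\<alpha> * s + q"] by (simp add: algebra_simps)
    moreover have "sin (p - q)
        = sin (\<alpha> * s + p) * cos (\<alpha> * s + q) - cos (\<alpha> * s + p) * sin (\<alpha> * s + q)"
      using sin_diff[of "\<alpha> * s + p" "\<alpha> * s + q"] by simp
    ultimately have eq: "sin (\<alpha> * s + p) * cos (\<alpha> * s + q)
        = sin (p - q) / 2 + sin (2 * \<alpha> * s + (p + q)) / 2"
      by linarith
    show "(F has_vector_derivative sin (\<alpha> * s + p) * cos (\<alpha> * s + q)) (at s within {0..2 * pi / \<alpha>})"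
      unfolding F_def has_real_derivative_iff_has_vector_derivative[symmetric] eq
      using assms by (auto intro!: derivative_eq_intros simp: field_simps)
  qed (use assms in simp)
  moreover have "cos (2 * \<alpha> * (2 * pi / \<alpha>) + (p + q)) = cos (p + q)"
  proof -
    have "2 * \<alpha> * (2 * pi / \<alpha>) + (p + q) = (p + q + 2 * pi) + 2 * pi"
      using assms by simp
    then show ?thesis
      by (simp only: cos_periodic)
  qed
  ultimately show ?thesis
    using assms by (simp add: F_def mult_ac)
qed

lemma period_integral_sin_sin:
  assumes "\<alpha> > 0"
  shows "((\<lambda>s. sin (\<alpha> * s + p) * sin (\<alpha> * s + q)) has_integral (pi / \<alpha> * cos (p - q)))
    {0..2 * pi / \<alpha>}"
proof -
  have "cos (\<alpha> * s + (q - pi / 2)) = sin (\<alpha> * s + q)" for s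
    by (simp add: cos_diff add_diff_eq)
  moreover have "sin (p - (q - pi / 2)) = cos (p - q)"
    by (simp add: sin_diff cos_diff)
  ultimately show ?thesis
    using period_integral_sin_cos[OF assms, of p "q - pi / 2"] by simp
qed

text \<open>
  The terms are grouped by the phase difference that the averaging over \<open>x\<^sub>1\<close> produces, and each
  is written as a product of a function of \<open>y\<close>, one of \<open>z\<close> and one of \<open>w\<close>. Each factor is a
  product of two sines or cosines of the same variable, hence has period \<open>\<pi>\<close> and only the
  frequencies \<open>-2, 0, 2\<close>.
\<close>

definition mean_profile :: "real^4 \<Rightarrow> real \<Rightarrow> real \<Rightarrow> real \<Rightarrow> real" where
  "mean_profile \<xi> y z w =
    (let S = (\<lambda>u i. sin (u + \<xi>$i)); C = (\<lambda>u i. cos (u + \<xi>$i)) in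
      sin (\<xi>$4 - \<xi>$1) * (S y 1 * S y 2) * (C z 2 * S z 3) * (S w 3 * C w 4)
    + sin (\<xi>$4 - \<xi>$1) * (C y 1 * C y 2) * (S z 2 * C z 3) * (S w 3 * C w 4)
    + sin (\<xi>$4 - \<xi>$2) * (S y 1 * C y 3) * (C z 2 * C z 4) * (C w 1 * S w 3)
    + sin (\<xi>$4 - \<xi>$2) * (C y 1 * S y 3) * (S z 2 * S z 4) * (C w 1 * S w 3)
    + sin (\<xi>$2 - \<xi>$1) * (S y 2 * C y 3) * (S z 3 * C z 4) * (C w 1 * C w 4)
    + sin (\<xi>$2 - \<xi>$1) * (C y 2 * S y 3) * (S z 3 * C z 4) * (S w 1 * S w 4)
    + cos (\<xi>$3 - \<xi>$1) * (C y 2 * C y 4) * (S z 1 * C z 3) * (C w 2 * C w 4)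
    + cos (\<xi>$3 - \<xi>$1) * (C y 2 * C y 4) * (C z 1 * S z 3) * (S w 2 * S w 4)
    + cos (\<xi>$3 - \<xi>$2) * (S y 3 * C y 4) * (S z 1 * S z 4) * (C w 1 * C w 2)
    - cos (\<xi>$3 - \<xi>$2) * (S y 3 * C y 4) * (C z 1 * C z 4) * (S w 1 * S w 2))"

text \<open>
  In \<open>x\<^sub>1\<close> the velocity components and the derivatives of \<open>v\<^sub>1\<close> are combinations of two waves
  each, so the average is found by inserting the integrals of products of two waves. The names
  in the proof stand for the coefficients, in units of \<open>v\<close> and \<open>\<alpha> v\<close>: \<open>v\<^sub>1 = S 1 A - S 2 B\<close>,
  \<open>\<partial>\<^sub>j v\<^sub>1 = S 1 Aj + S 2 Bj\<close> for \<open>j = 2, 3, 4\<close>, and \<open>Pj, Qj\<close> belong to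
  \<open>v\<^sub>j\<close>.
\<close>

lemma V1_eq:
  assumes "\<alpha> > 0"
  shows "V1 \<alpha> v \<xi> x = \<alpha> * v\<^sup>2 / 2 * mean_profile \<xi> (\<alpha> * x$2) (\<alpha> * x$3) (\<alpha> * x$4)"
proof -
  define y z w where yzw: "y = \<alpha> * x$2" "z = \<alpha> * x$3" "w = \<alpha> * x$4"
  define A B where AB:
    "A = cos (y + \<xi>$2) * sin (z + \<xi>$3) * cos (w + \<xi>$4)"
    "B = sin (y + \<xi>$3) * cos (z + \<xi>$4) * cos (w + \<xi>$1)"
  define A2 B2 A3 B3 A4 B4 where dAB:
    "A2 = - sin (y + \<xi>$2) * sin (z + \<xi>$3) * cos (w + \<xi>$4)"
    "B2 = - cos (y + \<xi>$3) * cos (z + \<xi>$4) * cos (w + \<xi>$1)"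
    "A3 = cos (y + \<xi>$2) * cos (z + \<xi>$3) * cos (w + \<xi>$4)"
    "B3 = sin (y + \<xi>$3) * sin (z + \<xi>$4) * cos (w + \<xi>$1)"
    "A4 = - cos (y + \<xi>$2) * sin (z + \<xi>$3) * sin (w + \<xi>$4)"
    "B4 = sin (y + \<xi>$3) * cos (z + \<xi>$4) * sin (w + \<xi>$1)"
  define P2 Q2 P3 Q3 P4 Q4 where PQ:
    "P2 = sin (y + \<xi>$1) * cos (z + \<xi>$2) * sin (w + \<xi>$3)"
    "Q2 = sin (y + \<xi>$2) * sin (z + \<xi>$3) * cos (w + \<xi>$4)"
    "P3 = cos (y + \<xi>$4) * sin (z + \<xi>$1) * cos (w + \<xi>$2)"
    "Q3 = cos (y + \<xi>$1) * sin (z + \<xi>$2) * sin (w + \<xi>$3)"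
    "P4 = sin (y + \<xi>$3) * cos (z + \<xi>$4) * sin (w + \<xi>$1)"
    "Q4 = cos (y + \<xi>$4) * cos (z + \<xi>$1) * sin (w + \<xi>$2)"
  define S C where SC: "S i s = sin (\<alpha> * s + \<xi>$i)" "C i s = cos (\<alpha> * s + \<xi>$i)" for i s
  have conv: "conv_field \<alpha> v \<xi> (\<chi> j. if j = 1 then s else x $ j) $ 1 = \<alpha> * v\<^sup>2 *
     (A\<^sup>2 * (S 1 s * C 1 s) - A * B * (S 1 s * C 2 s) - A * B * (S 2 s * C 1 s) + B\<^sup>2 * (S 2 s * C 2 s)
    + P2 * A2 * (S 1 s * C 4 s) - Q2 * A2 * (S 1 s * C 1 s) + P2 * B2 * (S 2 s * C 4 s) - Q2 * B2 * (S 2 s * C 1 s)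
    + P3 * A3 * (S 1 s * S 3 s) - Q3 * A3 * (S 1 s * C 4 s) + P3 * B3 * (S 2 s * S 3 s) - Q3 * B3 * (S 2 s * C 4 s)
    + P4 * A4 * (S 1 s * C 2 s) - Q4 * A4 * (S 1 s * S 3 s) + P4 * B4 * (S 2 s * C 2 s) - Q4 * B4 * (S 2 s * S 3 s))"
    (is "_ = \<alpha> * v\<^sup>2 * ?I s") for s
  proof -
    let ?X = "\<chi> j. if j = 1 then s else x $ j"
    have v: "vfield \<alpha> v \<xi> ?X $ 1 = v * (S 1 s * A - S 2 s * B)"
      "vfield \<alpha> v \<xi> ?X $ 2 = v * (C 4 s * P2 - C 1 s * Q2)"
      "vfield \<alpha> v \<xi> ?X $ 3 = v * (S 3 s * P3 - C 4 s * Q3)"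
      "vfield \<alpha> v \<xi> ?X $ 4 = v * (C 2 s * P4 - S 3 s * Q4)"
      by (simp_all add: vfield_nth AB PQ yzw SC mult_ac)
    have d: "partial 1 (\<lambda>y. vfield \<alpha> v \<xi> y $ 1) ?X = v * \<alpha> * (C 1 s * A - C 2 s * B)"
      "partial 2 (\<lambda>y. vfield \<alpha> v \<xi> y $ 1) ?X = v * \<alpha> * (S 1 s * A2 + S 2 s * B2)"
      "partial 3 (\<lambda>y. vfield \<alpha> v \<xi> y $ 1) ?X = v * \<alpha> * (S 1 s * A3 + S 2 s * B3)"
      "partial 4 (\<lambda>y. vfield \<alpha> v \<xi> y $ 1) ?X = v * \<alpha> * (S 1 s * A4 + S 2 s * B4)"
      by (simp_all add: partial_vfield_1 AB dAB yzw SC mult_ac)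
    show ?thesis
      unfolding conv_field_def sum_4 vec_lambda_beta v d by algebra
  qed
  have "((\<lambda>s. \<alpha> * v\<^sup>2 * ?I s) has_integral \<alpha> * v\<^sup>2 *
     (A\<^sup>2 * (pi / \<alpha> * sin (\<xi>$1 - \<xi>$1)) - A * B * (pi / \<alpha> * sin (\<xi>$1 - \<xi>$2))
       - A * B * (pi / \<alpha> * sin (\<xi>$2 - \<xi>$1)) + B\<^sup>2 * (pi / \<alpha> * sin (\<xi>$2 - \<xi>$2))
    + P2 * A2 * (pi / \<alpha> * sin (\<xi>$1 - \<xi>$4)) - Q2 * A2 * (pi / \<alpha> * sin (\<xi>$1 - \<xi>$1))
       + P2 * B2 * (pi / \<alpha> * sin (\<xi>$2 - \<xi>$4)) - Q2 * B2 * (pi / \<alpha> * sin (\<xi>$2 - \<xi>$1))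
    + P3 * A3 * (pi / \<alpha> * cos (\<xi>$1 - \<xi>$3)) - Q3 * A3 * (pi / \<alpha> * sin (\<xi>$1 - \<xi>$4))
       + P3 * B3 * (pi / \<alpha> * cos (\<xi>$2 - \<xi>$3)) - Q3 * B3 * (pi / \<alpha> * sin (\<xi>$2 - \<xi>$4))
    + P4 * A4 * (pi / \<alpha> * sin (\<xi>$1 - \<xi>$2)) - Q4 * A4 * (pi / \<alpha> * cos (\<xi>$1 - \<xi>$3))
       + P4 * B4 * (pi / \<alpha> * sin (\<xi>$2 - \<xi>$2)) - Q4 * B4 * (pi / \<alpha> * cos (\<xi>$2 - \<xi>$3))))
    {0..2 * pi / \<alpha>}" (is "(_ has_integral ?J) _")
    unfolding SC
    by (intro has_integral_mult_right has_integral_add has_integral_diff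
          period_integral_sin_cos period_integral_sin_sin assms)
  then have "V1 \<alpha> v \<xi> x = \<alpha> / (2 * pi) * ?J"
    unfolding V1_def conv by (simp only: integral_unique)
  also have "\<dots> = \<alpha> * v\<^sup>2 / 2 *
     (sin (\<xi>$4 - \<xi>$1) * (Q3 * A3 - P2 * A2) - sin (\<xi>$4 - \<xi>$2) * (P2 * B2 - Q3 * B3)
      - sin (\<xi>$2 - \<xi>$1) * (Q2 * B2 + P4 * A4)
      + cos (\<xi>$3 - \<xi>$1) * (P3 * A3 - Q4 * A4) + cos (\<xi>$3 - \<xi>$2) * (P3 * B3 - Q4 * B4))"
  proof -
    have flip: "sin (\<xi>$1 - \<xi>$2) = - sin (\<xi>$2 - \<xi>$1)" "sin (\<xi>$1 - \<xi>$4) = - sin (\<xi>$4 - \<xi>$1)"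
      "sin (\<xi>$2 - \<xi>$4) = - sin (\<xi>$4 - \<xi>$2)" "cos (\<xi>$1 - \<xi>$3) = cos (\<xi>$3 - \<xi>$1)"
      "cos (\<xi>$2 - \<xi>$3) = cos (\<xi>$3 - \<xi>$2)"
      by (simp_all add: sin_diff cos_diff)
    show ?thesis
      unfolding flip using assms by (simp add: field_simps)
  qed
  also have "\<dots> = \<alpha> * v\<^sup>2 / 2 * mean_profile \<xi> y z w"
    unfolding mean_profile_def Let_def AB dAB PQ by (simp add: algebra_simps)
  finally show ?thesis
    by (simp add: yzw)
qed

section \<open>Fourier modes of the averaged field\<close>

lemma sin_cos_add_half_pi:
  fixes y p :: real
  shows "sin (y + pi / 2 + p) = cos (y + p)" "cos (y + pi / 2 + p) = - sin (y + p)"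
  by (simp_all add: sin_add cos_add)

text \<open>
  A shift by \<open>\<pi>/2\<close> exchanges sine and cosine up to sign. So these are the differences and the
  sums of the values at \<open>y\<close> and \<open>y + \<pi>/2\<close> of a product of two waves: a difference keeps the
  frequency \<open>2\<close>, a sum keeps the mean.
\<close>

lemma wave_pair_combinations:
  fixes y p q :: real
  shows "sin (y + p) * sin (y + q) - cos (y + p) * cos (y + q) = - cos (2 * y + p + q)"
    "cos (y + p) * cos (y + q) - sin (y + p) * sin (y + q) = cos (2 * y + p + q)"
    "sin (y + p) * cos (y + q) + cos (y + p) * sin (y + q) = sin (2 * y + p + q)"
    "cos (y + p) * sin (y + q) + sin (y + p) * cos (y + q) = sin (2 * y + p + q)"
    "sin (y + p) * sin (y + q) + cos (y + p) * cos (y + q) = cos (p - q)"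
    "cos (y + p) * cos (y + q) + sin (y + p) * sin (y + q) = cos (p - q)"
    "sin (y + p) * cos (y + q) - cos (y + p) * sin (y + q) = sin (p - q)"
    "cos (y + p) * sin (y + q) - sin (y + p) * cos (y + q) = sin (q - p)"
  using cos_add[of "y + p" "y + q"] sin_add[of "y + p" "y + q"]
    cos_diff[of "y + p" "y + q"] sin_diff[of "y + p" "y + q"] sin_diff[of "y + q" "y + p"]
  by (simp_all add: algebra_simps)

lemma cos_diff_commute: "cos (a - b) = cos (b - a)" for a b :: real
  by (simp add: cos_diff mult.commute)

lemma sin_diff_commute: "sin (a - b) = - sin (b - a)" for a b :: real
  by (simp add: sin_diff)

text \<open>
  The combination on the left acts on each term factor by factor: it takes differences in \<open>y\<close> and
  \<open>z\<close> and the sum in \<open>w\<close>. So it is the part of the polynomial with frequencies \<open>\<plusminus>2\<close> in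
  \<open>y\<close> and \<open>z\<close> and \<open>0\<close> in \<open>w\<close>, up to a factor. Of the ten resulting products, the first
  four cancel in pairs and the others coincide in pairs.
\<close>

lemma mean_profile_modes_yz:
  fixes h :: real
  defines "h \<equiv> pi / 2"
  shows "(mean_profile \<xi> y z w - mean_profile \<xi> (y + h) z w
    - mean_profile \<xi> y (z + h) w + mean_profile \<xi> (y + h) (z + h) w
    + mean_profile \<xi> y z (w + h) - mean_profile \<xi> (y + h) z (w + h)
    - mean_profile \<xi> y (z + h) (w + h) + mean_profile \<xi> (y + h) (z + h) (w + h)) / 2
    = sin (\<xi>$2 - \<xi>$1) * cos (\<xi>$4 - \<xi>$1) * (sin (2 * y + \<xi>$2 + \<xi>$3) * sin (2 * z + \<xi>$3 + \<xi>$4))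
      + cos (\<xi>$3 - \<xi>$1) * cos (\<xi>$4 - \<xi>$2) * (cos (2 * y + \<xi>$2 + \<xi>$4) * sin (2 * z + \<xi>$1 + \<xi>$3))
      - cos (\<xi>$3 - \<xi>$2) * cos (\<xi>$2 - \<xi>$1) * (sin (2 * y + \<xi>$3 + \<xi>$4) * cos (2 * z + \<xi>$1 + \<xi>$4))"
    (is "?L / 2 = ?R")
proof -
  let ?S = "\<lambda>u i. sin (u + \<xi>$i)" and ?C = "\<lambda>u i. cos (u + \<xi>$i)"
  have "?L =
      sin (\<xi>$4 - \<xi>$1) * (?S y 1 * ?S y 2 - ?C y 1 * ?C y 2)
        * (?C z 2 * ?S z 3 + ?S z 2 * ?C z 3) * (?S w 3 * ?C w 4 - ?C w 3 * ?S w 4)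
    + sin (\<xi>$4 - \<xi>$1) * (?C y 1 * ?C y 2 - ?S y 1 * ?S y 2)
        * (?S z 2 * ?C z 3 + ?C z 2 * ?S z 3) * (?S w 3 * ?C w 4 - ?C w 3 * ?S w 4)
    + sin (\<xi>$4 - \<xi>$2) * (?S y 1 * ?C y 3 + ?C y 1 * ?S y 3)
        * (?C z 2 * ?C z 4 - ?S z 2 * ?S z 4) * (?C w 1 * ?S w 3 - ?S w 1 * ?C w 3)
    + sin (\<xi>$4 - \<xi>$2) * (?C y 1 * ?S y 3 + ?S y 1 * ?C y 3)
        * (?S z 2 * ?S z 4 - ?C z 2 * ?C z 4) * (?C w 1 * ?S w 3 - ?S w 1 * ?C w 3)
    + sin (\<xi>$2 - \<xi>$1) * (?S y 2 * ?C y 3 + ?C y 2 * ?S y 3)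
        * (?S z 3 * ?C z 4 + ?C z 3 * ?S z 4) * (?C w 1 * ?C w 4 + ?S w 1 * ?S w 4)
    + sin (\<xi>$2 - \<xi>$1) * (?C y 2 * ?S y 3 + ?S y 2 * ?C y 3)
        * (?S z 3 * ?C z 4 + ?C z 3 * ?S z 4) * (?S w 1 * ?S w 4 + ?C w 1 * ?C w 4)
    + cos (\<xi>$3 - \<xi>$1) * (?C y 2 * ?C y 4 - ?S y 2 * ?S y 4)
        * (?S z 1 * ?C z 3 + ?C z 1 * ?S z 3) * (?C w 2 * ?C w 4 + ?S w 2 * ?S w 4)
    + cos (\<xi>$3 - \<xi>$1) * (?C y 2 * ?C y 4 - ?S y 2 * ?S y 4)
        * (?C z 1 * ?S z 3 + ?S z 1 * ?C z 3) * (?S w 2 * ?S w 4 + ?C w 2 * ?C w 4)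
    + cos (\<xi>$3 - \<xi>$2) * (?S y 3 * ?C y 4 + ?C y 3 * ?S y 4)
        * (?S z 1 * ?S z 4 - ?C z 1 * ?C z 4) * (?C w 1 * ?C w 2 + ?S w 1 * ?S w 2)
    - cos (\<xi>$3 - \<xi>$2) * (?S y 3 * ?C y 4 + ?C y 3 * ?S y 4)
        * (?C z 1 * ?C z 4 - ?S z 1 * ?S z 4) * (?S w 1 * ?S w 2 + ?C w 1 * ?C w 2)"
    unfolding mean_profile_def Let_def h_def sin_cos_add_half_pi by (simp add: algebra_simps)
  also have "\<dots> = ?R * 2"
    unfolding wave_pair_combinations cos_diff_commute[of "\<xi>$1" "\<xi>$4"]
      cos_diff_commute[of "\<xi>$2" "\<xi>$4"] cos_diff_commute[of "\<xi>$1" "\<xi>$2"]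
    by algebra
  finally show ?thesis
    by (rule divide_eq_imp[rotated]) simp
qed

text \<open>
  The same with the frequencies \<open>\<plusminus>2\<close> in \<open>z\<close> and \<open>w\<close> and the mean in \<open>y\<close>; now the
  terms with a cosine as coefficient cancel and the others coincide in pairs.
\<close>

lemma mean_profile_modes_zw:
  fixes h :: real
  defines "h \<equiv> pi / 2"
  shows "(mean_profile \<xi> y z w - mean_profile \<xi> y (z + h) w
    - mean_profile \<xi> y z (w + h) + mean_profile \<xi> y (z + h) (w + h)
    + mean_profile \<xi> (y + h) z w - mean_profile \<xi> (y + h) (z + h) w
    - mean_profile \<xi> (y + h) z (w + h) + mean_profile \<xi> (y + h) (z + h) (w + h)) / 2
    = sin (\<xi>$4 - \<xi>$1) * cos (\<xi>$2 - \<xi>$1) * (sin (2 * z + \<xi>$2 + \<xi>$3) * sin (2 * w + \<xi>$3 + \<xi>$4))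
      - sin (\<xi>$4 - \<xi>$2) * sin (\<xi>$3 - \<xi>$1) * (cos (2 * z + \<xi>$2 + \<xi>$4) * sin (2 * w + \<xi>$1 + \<xi>$3))
      - sin (\<xi>$2 - \<xi>$1) * sin (\<xi>$3 - \<xi>$2) * (sin (2 * z + \<xi>$3 + \<xi>$4) * cos (2 * w + \<xi>$1 + \<xi>$4))"
    (is "?L / 2 = ?R")
proof -
  let ?S = "\<lambda>u i. sin (u + \<xi>$i)" and ?C = "\<lambda>u i. cos (u + \<xi>$i)"
  have "?L =
      sin (\<xi>$4 - \<xi>$1) * (?S y 1 * ?S y 2 + ?C y 1 * ?C y 2)
        * (?C z 2 * ?S z 3 + ?S z 2 * ?C z 3) * (?S w 3 * ?C w 4 + ?C w 3 * ?S w 4)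
    + sin (\<xi>$4 - \<xi>$1) * (?C y 1 * ?C y 2 + ?S y 1 * ?S y 2)
        * (?S z 2 * ?C z 3 + ?C z 2 * ?S z 3) * (?S w 3 * ?C w 4 + ?C w 3 * ?S w 4)
    + sin (\<xi>$4 - \<xi>$2) * (?S y 1 * ?C y 3 - ?C y 1 * ?S y 3)
        * (?C z 2 * ?C z 4 - ?S z 2 * ?S z 4) * (?C w 1 * ?S w 3 + ?S w 1 * ?C w 3)
    + sin (\<xi>$4 - \<xi>$2) * (?C y 1 * ?S y 3 - ?S y 1 * ?C y 3)
        * (?S z 2 * ?S z 4 - ?C z 2 * ?C z 4) * (?C w 1 * ?S w 3 + ?S w 1 * ?C w 3)
    + sin (\<xi>$2 - \<xi>$1) * (?S y 2 * ?C y 3 - ?C y 2 * ?S y 3)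
        * (?S z 3 * ?C z 4 + ?C z 3 * ?S z 4) * (?C w 1 * ?C w 4 - ?S w 1 * ?S w 4)
    + sin (\<xi>$2 - \<xi>$1) * (?C y 2 * ?S y 3 - ?S y 2 * ?C y 3)
        * (?S z 3 * ?C z 4 + ?C z 3 * ?S z 4) * (?S w 1 * ?S w 4 - ?C w 1 * ?C w 4)
    + cos (\<xi>$3 - \<xi>$1) * (?C y 2 * ?C y 4 + ?S y 2 * ?S y 4)
        * (?S z 1 * ?C z 3 + ?C z 1 * ?S z 3) * (?C w 2 * ?C w 4 - ?S w 2 * ?S w 4)
    + cos (\<xi>$3 - \<xi>$1) * (?C y 2 * ?C y 4 + ?S y 2 * ?S y 4)
        * (?C z 1 * ?S z 3 + ?S z 1 * ?C z 3) * (?S w 2 * ?S w 4 - ?C w 2 * ?C w 4)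
    + cos (\<xi>$3 - \<xi>$2) * (?S y 3 * ?C y 4 - ?C y 3 * ?S y 4)
        * (?S z 1 * ?S z 4 - ?C z 1 * ?C z 4) * (?C w 1 * ?C w 2 - ?S w 1 * ?S w 2)
    - cos (\<xi>$3 - \<xi>$2) * (?S y 3 * ?C y 4 - ?C y 3 * ?S y 4)
        * (?C z 1 * ?C z 4 - ?S z 1 * ?S z 4) * (?S w 1 * ?S w 2 - ?C w 1 * ?C w 2)"
    unfolding mean_profile_def Let_def h_def sin_cos_add_half_pi by (simp add: algebra_simps)
  also have "\<dots> = ?R * 2"
    unfolding wave_pair_combinations cos_diff_commute[of "\<xi>$1" "\<xi>$2"]
      sin_diff_commute[of "\<xi>$2" "\<xi>$3"] sin_diff_commute[of "\<xi>$1" "\<xi>$3"]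
    by algebra
  finally show ?thesis
    by (rule divide_eq_imp[rotated]) simp
qed

section \<open>The equations for the phases\<close>

text \<open>
  Sum and difference of the first two hypotheses, and the third one, are the equations for \<open>n, m, r\<close>
  of the introduction, up to sign. They are brought to this form by product-to-sum formulas.
\<close>

lemma mode_equations:
  fixes a b c :: real
  assumes SA: "sin a * cos (a + b + c) * sin (b + c) - cos (a + b) * cos (b + c) * cos (a + c)
      - cos b * cos a * cos (a + b) = 0"
    and SB: "sin (a + b + c) * cos a * sin (b + c) + sin (b + c) * sin (a + b) * cos (a + c)
      - sin a * sin b * cos (a + b) = 0"
    and CA: "sin a * cos (a + b + c) * cos (b + c) - cos (a + b) * cos (b + c) * sin (a + c)
      - cos b * cos a * sin (a + b) = 0"
  shows "cos (a + b) = 0" "sin (b + c) = 0"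
proof -
  define n m r where nmr: "n = a + c" "m = a - c" "r = (a + b) + (b + c)"
  define s t where st: "s = a + b" "t = b + c"
  have SA': "sin t * (sin a * cos (a + t)) - cos n * (cos s * cos t) - cos s * (cos a * cos b) = 0"
    using SA by (simp add: st nmr mult_ac add_ac)
  have SB': "sin t * (cos a * sin (a + t)) + cos n * (sin s * sin t) - cos s * (sin a * sin b) = 0"
    using SB by (simp add: st nmr mult_ac add_ac)
  have CA': "cos t * (sin a * cos (a + t)) - sin n * (cos s * cos t) - sin s * (cos a * cos b) = 0"
    using CA by (simp add: st nmr mult_ac add_ac)
  have "sin t * sin (a + (a + t)) - cos n * cos (s + t) - cos s * cos (a - b) = 0"
    using SA' SB' unfolding sin_add[of a "a + t"] cos_add[of s t] cos_diff[of a b]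
    by (simp add: algebra_simps)
  moreover have "sin t * sin (a + (a + t)) = (cos (2 * a) - cos (2 * a + 2 * t)) / 2"
    using sin_times_sin[of "a + (a + t)" t] by (simp add: algebra_simps)
  moreover have "cos s * cos (a - b) = (cos (2 * a) + cos (2 * b)) / 2"
    using cos_times_cos[of s "a - b"] by (simp add: st algebra_simps)
  moreover have "cos n * cos (s + t) = (cos (2 * b) + cos (2 * a + 2 * t)) / 2"
    using cos_times_cos[of "s + t" n] by (simp add: st nmr algebra_simps)
  ultimately have "cos n * cos (s + t) = 0"
    by argo
  then have E1: "cos r * cos n = 0"
    by (auto simp: nmr st)
  have "sin t * sin (a - (a + t)) - cos n * cos (s - t) - cos s * cos (a + b) = 0"
    using SA' SB' unfolding sin_diff[of a "a + t"] cos_diff[of s t] cos_add[of a b]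
    by (simp add: algebra_simps)
  moreover have "s - t = m" "a + b = s"
    by (simp_all add: st nmr)
  ultimately have "(sin t)\<^sup>2 + cos n * cos m + (cos s)\<^sup>2 = 0"
    by (simp add: power2_eq_square)
  moreover have "sin r * sin m = 1 - (sin t)\<^sup>2 - (cos s)\<^sup>2"
    using sin_times_sin[of r m] cos_double_cos[of s] cos_double_sin[of t]
    by (simp add: st nmr algebra_simps)
  ultimately have E2: "1 + cos n * cos m = sin r * sin m"
    by simp
  have "cos t * (sin a * cos (a + t)) = (sin (2 * a + 2 * t) + sin (2 * a)) / 4 - sin (2 * t) / 4"
  proof -
    have p: "sin a * cos (a + t) = (sin (2 * a + t) - sin t) / 2"
      using sin_times_cos[of a "a + t"] by (simp add: algebra_simps)
    have q: "cos t * sin (2 * a + t) = (sin (2 * a + 2 * t) + sin (2 * a)) / 2"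
      using sin_times_cos[of "2 * a + t" t] by (simp add: algebra_simps)
    have "cos t * ((sin (2 * a + t) - sin t) / 2) = (cos t * sin (2 * a + t)) / 2 - (2 * sin t * cos t) / 4"
      by (simp add: field_simps)
    then show ?thesis
      unfolding p q sin_double by simp
  qed
  moreover have "sin n * (cos s * cos t) = (sin (2 * a + 2 * t) - sin (2 * b)) / 4 + cos m * sin n / 2"
  proof -
    have p: "cos s * cos t = (cos m + cos r) / 2"
      using cos_times_cos[of s t] by (simp add: nmr st algebra_simps)
    have q: "sin n * cos r = (sin (2 * a + 2 * t) - sin (2 * b)) / 2"
      using sin_times_cos[of n r] sin_minus[of "2 * b"] by (simp add: nmr st algebra_simps)
    have "sin n * ((cos m + cos r) / 2) = (sin n * cos r) / 2 + cos m * sin n / 2"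
      by (simp add: field_simps)
    then show ?thesis
      unfolding p q by simp
  qed
  moreover have "sin s * (cos a * cos b) = sin (2 * s) / 4 + (sin (2 * a) + sin (2 * b)) / 4"
  proof -
    have p: "cos a * cos b = (cos (a - b) + cos s) / 2"
      using cos_times_cos[of a b] by (simp add: st)
    have q: "sin s * cos (a - b) = (sin (2 * a) + sin (2 * b)) / 2"
      using sin_times_cos[of s "a - b"] by (simp add: st algebra_simps)
    have "sin s * ((cos (a - b) + cos s) / 2) = (2 * sin s * cos s) / 4 + (sin s * cos (a - b)) / 2"
      by (simp add: field_simps)
    then show ?thesis
      unfolding p q sin_double by simp
  qed
  moreover have "cos m * sin r = (sin (2 * s) + sin (2 * t)) / 2"
    using sin_times_cos[of r m] by (simp add: nmr st algebra_simps)
  ultimately have E3: "cos m * (sin n + sin r) = 0"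
    using CA' unfolding distrib_left by argo
  \<comment> \<open>If \<open>cos n = 0\<close>, then \<open>sin r sin m = 1\<close> leaves no room for \<open>cos m\<close>. Otherwise \<open>cos r = 0\<close>, and
    \<open>cos m \<noteq> 0\<close> would give \<open>sin n = - sin r = \<plusminus>1\<close>, hence \<open>cos n = 0\<close> after all.\<close>
  have "cos m = 0 \<and> sin r * sin m = 1"
  proof (cases "cos n = 0")
    case True
    then have "sin r * sin m = 1"
      using E2 by simp
    then have "(sin r)\<^sup>2 * (sin m)\<^sup>2 = 1"
      by (metis power_mult_distrib one_power2)
    moreover have "(sin r)\<^sup>2 * (sin m)\<^sup>2 \<le> (sin m)\<^sup>2"
      by (rule mult_left_le_one_le) (simp_all add: abs_square_le_1)
    ultimately have "(cos m)\<^sup>2 \<le> 0"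
      by (simp add: cos_squared_eq)
    with \<open>sin r * sin m = 1\<close> show ?thesis
      by simp
  next
    case False
    then have r: "cos r = 0" using E1 by simp
    show ?thesis
    proof (cases "cos m = 0")
      case True
      then show ?thesis using E2 by simp
    next
      case False
      then have "sin n = - sin r" using E3 by simp
      moreover have "(sin r)\<^sup>2 = 1" using r by (simp add: sin_squared_eq)
      ultimately have "(cos n)\<^sup>2 = 0" by (simp add: cos_squared_eq)
      with \<open>cos n \<noteq> 0\<close> show ?thesis by simp
    qed
  qed
  then have "cos (r + m) = -1" "cos (r - m) = 1"
    by (simp_all add: cos_add cos_diff)
  moreover have "r + m = 2 * (a + b)" "r - m = 2 * (b + c)"
    by (simp_all add: nmr)
  ultimately have dbl: "cos (2 * (a + b)) = -1" "cos (2 * (b + c)) = 1"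
    by (simp_all only:)
  show "cos (a + b) = 0"
    using dbl(1) unfolding cos_double_cos by simp
  show "sin (b + c) = 0"
    using dbl(2) unfolding cos_double_sin by simp
qed

text \<open>
  Evaluating the modes at \<open>(0,0), (\<pi>/4,\<pi>/4)\<close> and at \<open>(\<pi>/4,0), (0,\<pi>/4)\<close> yields the cosine
  and the sine of the difference of the two phases: in a product of a wave in \<open>y\<close> and a wave in
  \<open>z\<close>, the shift by \<open>\<pi>/4\<close> turns a sine of the double angle into a cosine and vice versa, up to sign.
  The three equations that result are those of \<open>mode_equations\<close>, in the successive phase
  differences \<open>a, b, c\<close>.
\<close>

lemma mean_profile_eq_0_imp:
  assumes "\<And>y z w. mean_profile \<xi> y z w = 0"
  shows "cos (\<xi>$3 - \<xi>$1) = 0" "sin (\<xi>$4 - \<xi>$2) = 0"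
proof -
  define a b c where abc: "a = \<xi>$2 - \<xi>$1" "b = \<xi>$3 - \<xi>$2" "c = \<xi>$4 - \<xi>$3"
  define p where "p = \<xi>$1"
  have xi: "\<xi>$1 = p" "\<xi>$2 = p + a" "\<xi>$3 = p + a + b" "\<xi>$4 = p + a + b + c"
    by (simp_all add: abc p_def)
  have d: "\<xi>$2 - \<xi>$1 = a" "\<xi>$3 - \<xi>$2 = b" "\<xi>$3 - \<xi>$1 = a + b"
    "\<xi>$4 - \<xi>$2 = b + c" "\<xi>$4 - \<xi>$1 = a + b + c"
    by (simp_all add: xi)
  have A: "sin a * cos (a + b + c) * (sin (2 * y + \<xi>$2 + \<xi>$3) * sin (2 * z + \<xi>$3 + \<xi>$4))
      + cos (a + b) * cos (b + c) * (cos (2 * y + \<xi>$2 + \<xi>$4) * sin (2 * z + \<xi>$1 + \<xi>$3))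
      - cos b * cos a * (sin (2 * y + \<xi>$3 + \<xi>$4) * cos (2 * z + \<xi>$1 + \<xi>$4)) = 0" for y z
    using mean_profile_modes_yz[of \<xi> y z 0] unfolding assms d by simp
  have B: "sin (a + b + c) * cos a * (sin (2 * z + \<xi>$2 + \<xi>$3) * sin (2 * w + \<xi>$3 + \<xi>$4))
      - sin (b + c) * sin (a + b) * (cos (2 * z + \<xi>$2 + \<xi>$4) * sin (2 * w + \<xi>$1 + \<xi>$3))
      - sin a * sin b * (sin (2 * z + \<xi>$3 + \<xi>$4) * cos (2 * w + \<xi>$1 + \<xi>$4)) = 0" for z w
    using mean_profile_modes_zw[of \<xi> 0 z w] unfolding assms d by simp
  have quarter: "sin (2 * (pi / 4) + u + v) = cos (u + v)" "cos (2 * (pi / 4) + u + v) = - sin (u + v)" for u v :: real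
    using sin_add[of "pi / 2" "u + v"] cos_add[of "pi / 2" "u + v"] by (simp_all add: add.assoc)
  have XY: "sin X * sin Y + cos X * cos Y = cos (Y - X)" "cos X * sin Y - sin X * cos Y = sin (Y - X)"
    for X Y :: real
    by (simp_all add: cos_diff sin_diff mult_ac)
  have diffs: "(\<xi>$3 + \<xi>$4) - (\<xi>$2 + \<xi>$3) = b + c" "(\<xi>$1 + \<xi>$3) - (\<xi>$2 + \<xi>$4) = - (a + c)"
    "(\<xi>$1 + \<xi>$4) - (\<xi>$3 + \<xi>$4) = - (a + b)"
    by (simp_all add: xi)
  have "sin a * cos (a + b + c) * cos ((\<xi>$3 + \<xi>$4) - (\<xi>$2 + \<xi>$3))
      + cos (a + b) * cos (b + c) * sin ((\<xi>$1 + \<xi>$3) - (\<xi>$2 + \<xi>$4))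
      + cos b * cos a * sin ((\<xi>$1 + \<xi>$4) - (\<xi>$3 + \<xi>$4)) = 0"
    using A[of 0 0] A[of "pi / 4" "pi / 4"] unfolding quarter XY[symmetric]
    by (simp add: algebra_simps)
  then have CA: "sin a * cos (a + b + c) * cos (b + c) - cos (a + b) * cos (b + c) * sin (a + c)
      - cos b * cos a * sin (a + b) = 0"
    unfolding diffs sin_minus cos_minus by simp
  have "sin a * cos (a + b + c) * sin ((\<xi>$3 + \<xi>$4) - (\<xi>$2 + \<xi>$3))
      - cos (a + b) * cos (b + c) * cos ((\<xi>$1 + \<xi>$3) - (\<xi>$2 + \<xi>$4))
      - cos b * cos a * cos ((\<xi>$1 + \<xi>$4) - (\<xi>$3 + \<xi>$4)) = 0"
    using A[of "pi / 4" 0] A[of 0 "pi / 4"] unfolding quarter XY[symmetric]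
    by (simp add: algebra_simps)
  then have SA: "sin a * cos (a + b + c) * sin (b + c) - cos (a + b) * cos (b + c) * cos (a + c)
      - cos b * cos a * cos (a + b) = 0"
    unfolding diffs sin_minus cos_minus by simp
  have "sin (a + b + c) * cos a * sin ((\<xi>$3 + \<xi>$4) - (\<xi>$2 + \<xi>$3))
      + sin (b + c) * sin (a + b) * cos ((\<xi>$1 + \<xi>$3) - (\<xi>$2 + \<xi>$4))
      - sin a * sin b * cos ((\<xi>$1 + \<xi>$4) - (\<xi>$3 + \<xi>$4)) = 0"
    using B[of "pi / 4" 0] B[of 0 "pi / 4"] unfolding quarter XY[symmetric]
    by (simp add: algebra_simps)
  then have SB: "sin (a + b + c) * cos a * sin (b + c) + sin (b + c) * sin (a + b) * cos (a + c)
      - sin a * sin b * cos (a + b) = 0"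
    unfolding diffs sin_minus cos_minus by simp
  show "cos (\<xi>$3 - \<xi>$1) = 0" "sin (\<xi>$4 - \<xi>$2) = 0"
    using mode_equations[OF SA SB CA] by (simp_all add: xi)
qed

text \<open>
  A sine with phase \<open>\<xi>\<^sub>3\<close> is a cosine with phase \<open>\<xi>\<^sub>1\<close> here, after which the terms with the
  factor \<open>sin (\<xi>\<^sub>2 - \<xi>\<^sub>1)\<close> cancel in pairs and all other terms vanish.
\<close>

lemma mean_profile_eq_0:
  assumes "\<xi>$3 = \<xi>$1 + pi / 2" "\<xi>$4 = \<xi>$2"
  shows "mean_profile \<xi> y z w = 0"
proof -
  have "sin (u + \<xi>$3) = cos (u + \<xi>$1)" "cos (u + \<xi>$3) = - sin (u + \<xi>$1)" for u
    unfolding assms by (simp_all add: sin_add cos_add flip: add.assoc)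
  moreover have "cos (\<xi>$3 - \<xi>$1) = 0" "cos (\<xi>$3 - \<xi>$2) = sin (\<xi>$2 - \<xi>$1)"
    unfolding assms by (simp_all add: sin_diff cos_diff sin_add cos_add)
  ultimately show ?thesis
    unfolding mean_profile_def Let_def by (simp add: assms(2))
qed

section \<open>The exceptional phases and the symmetries of the field\<close>

lemma xi_family_nth [simp]:
  "xi_family \<theta> a l1 l2 l3 $ 1 = \<theta>"
  "xi_family \<theta> a l1 l2 l3 $ 2 = \<theta> + a + of_int l1 * pi"
  "xi_family \<theta> a l1 l2 l3 $ 3 = \<theta> + pi / 2 + of_int l2 * pi"
  "xi_family \<theta> a l1 l2 l3 $ 4 = \<theta> + a + of_int l3 * pi"
  by (simp_all add: xi_family_def vector_def)

lemma sin_cos_add_int_pi: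
  fixes l :: int
  shows "sin (u + of_int l * pi) = (-1) powi l * sin u" "cos (u + of_int l * pi) = (-1) powi l * cos u"
  by (simp_all add: sin_add cos_add sin_npi_int cos_npi_int mult.commute[of _ pi] power_int_minus_one_minus)

text \<open>
  Each of the two products in the field contains every phase exactly once. The sign is attached to
  the amplitude rather than to the field because the averaged convective field is already known for
  every real amplitude and depends only on its square.
\<close>

lemma vfield_sign:
  "vfield \<alpha> v (xi_family \<theta> a l1 l2 l3) x = vfield \<alpha> ((-1) powi (l1 + l2 + l3) * v) (xi_family \<theta> a 0 0 0) x"
proof -
  have sh: "sin (u + (p + of_int l * pi)) = (-1) powi l * sin (u + p)"
    "cos (u + (p + of_int l * pi)) = (-1) powi l * cos (u + p)" for u p and l :: int
    using sin_cos_add_int_pi[of "u + p" l] by (simp_all add: add.assoc)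
  show ?thesis
    unfolding vfield_def v1_def xi_family_nth sh
    by (simp add: vec_eq_iff power_int_add algebra_simps)
qed

lemma vfield_scale: "vfield \<alpha> (s * v) \<xi> x = s *\<^sub>R vfield \<alpha> v \<xi> x"
  by (simp add: vec_eq_iff vfield_def v1_def)

lemma vfield_translate:
  assumes "\<alpha> > 0"
  shows "vfield \<alpha> v (xi_family (\<theta> + \<delta>) a l1 l2 l3) x
        = vfield \<alpha> v (xi_family \<theta> a l1 l2 l3) (x + (\<delta> / \<alpha>) *\<^sub>R vector [1, 1, 1, 1])"
proof -
  have "(vector [1, 1, 1, 1] :: real^4) $ j = 1" for j
    using exhaust_4[of j] by (auto simp: vector_def)
  then show ?thesis
    using assms by (simp add: vec_eq_iff vfield_def v1_def algebra_simps)
qed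

lemma cos_zero_iff_int_pi: "cos x = 0 \<longleftrightarrow> (\<exists>k::int. x = pi / 2 + of_int k * pi)"
proof -
  have "cos x = 0 \<longleftrightarrow> sin (x - pi / 2) = 0"
    by (simp add: sin_diff)
  also have "\<dots> \<longleftrightarrow> (\<exists>k::int. x = pi / 2 + of_int k * pi)"
    by (auto simp: sin_zero_iff_int2 algebra_simps)
  finally show ?thesis .
qed

lemma in_xi_family_iff:
  "(\<exists>\<theta> a l1 l2 l3. \<xi> = xi_family \<theta> a l1 l2 l3) \<longleftrightarrow> cos (\<xi>$3 - \<xi>$1) = 0 \<and> sin (\<xi>$4 - \<xi>$2) = 0"
proof
  assume "\<exists>\<theta> a l1 l2 l3. \<xi> = xi_family \<theta> a l1 l2 l3"
  then obtain \<theta> a l1 l2 l3 where \<xi>: "\<xi> = xi_family \<theta> a l1 l2 l3"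
    by blast
  have "\<xi>$3 - \<xi>$1 = pi / 2 + of_int l2 * pi" "\<xi>$4 - \<xi>$2 = of_int (l3 - l1) * pi"
    by (simp_all add: \<xi> algebra_simps)
  then show "cos (\<xi>$3 - \<xi>$1) = 0 \<and> sin (\<xi>$4 - \<xi>$2) = 0"
    unfolding cos_zero_iff_int_pi sin_zero_iff_int2 by blast
next
  assume "cos (\<xi>$3 - \<xi>$1) = 0 \<and> sin (\<xi>$4 - \<xi>$2) = 0"
  then obtain k n where "\<xi>$3 - \<xi>$1 = pi / 2 + of_int k * pi" "\<xi>$4 - \<xi>$2 = of_int n * pi"
    by (auto simp: cos_zero_iff_int_pi sin_zero_iff_int2)
  then have "\<xi> = xi_family (\<xi>$1) (\<xi>$2 - \<xi>$1) 0 k n"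
    by (simp add: vec_eq_iff forall_4 algebra_simps)
  then show "\<exists>\<theta> a l1 l2 l3. \<xi> = xi_family \<theta> a l1 l2 l3"
    by blast
qed

lemma phase_congruences_iff:
  "[\<xi>$3 - \<xi>$2 = pi / 2 - (\<xi>$2 - \<xi>$1)] (rmod pi) \<and> [\<xi>$4 - \<xi>$3 = (\<xi>$2 - \<xi>$1) - pi / 2] (rmod pi)
   \<longleftrightarrow> cos (\<xi>$3 - \<xi>$1) = 0 \<and> sin (\<xi>$4 - \<xi>$2) = 0" (is "?B \<and> ?C \<longleftrightarrow> _") for \<xi> :: "real^4"
proof -
  have rcong_sin: "[u = v] (rmod pi) \<longleftrightarrow> sin (v - u) = 0" for u v
    by (auto simp: rcong_altdef sin_zero_iff_int2 algebra_simps)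
  have B: "?B \<longleftrightarrow> cos (\<xi>$3 - \<xi>$1) = 0"
    unfolding rcong_sin using cos_sin_eq[of "\<xi>$3 - \<xi>$1"] by (simp add: algebra_simps)
  \<comment> \<open>Adding the congruences for \<open>b\<close> and \<open>c\<close> gives one for \<open>b + c = \<xi>\<^sub>4 - \<xi>\<^sub>2\<close> with right side \<open>0\<close>.\<close>
  let ?sum = "[\<xi>$3 - \<xi>$2 + (\<xi>$4 - \<xi>$3) = (pi / 2 - (\<xi>$2 - \<xi>$1)) + ((\<xi>$2 - \<xi>$1) - pi / 2)] (rmod pi)"
  have "?sum \<longleftrightarrow> sin (\<xi>$4 - \<xi>$2) = 0"
    unfolding rcong_sin by (auto simp: sin_diff mult.commute)
  moreover have "?sum \<longleftrightarrow> ?C" if ?B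
  proof
    assume ?sum
    from rcong_diff[OF this that] show ?C
      unfolding add_diff_cancel_left' .
  qed (rule rcong_add[OF that])
  ultimately show ?thesis using B by blast
qed

lemma V1_zero_iff:
  assumes "\<alpha> > 0" and "v > 0"
  shows "(\<forall>x. V1 \<alpha> v \<xi> x = 0) \<longleftrightarrow> cos (\<xi>$3 - \<xi>$1) = 0 \<and> sin (\<xi>$4 - \<xi>$2) = 0"
proof
  assume V: "\<forall>x. V1 \<alpha> v \<xi> x = 0"
  have "mean_profile \<xi> y z w = 0" for y z w
    using V[rule_format, of "vector [0, y / \<alpha>, z / \<alpha>, w / \<alpha>]"] assms
    by (simp add: V1_eq vector_def)
  then show "cos (\<xi>$3 - \<xi>$1) = 0 \<and> sin (\<xi>$4 - \<xi>$2) = 0"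
    by (simp add: mean_profile_eq_0_imp)
next
  assume "cos (\<xi>$3 - \<xi>$1) = 0 \<and> sin (\<xi>$4 - \<xi>$2) = 0"
  then obtain \<theta> a l1 l2 l3 where \<xi>: "\<xi> = xi_family \<theta> a l1 l2 l3"
    using in_xi_family_iff by blast
  have "V1 \<alpha> v \<xi> = V1 \<alpha> ((-1) powi (l1 + l2 + l3) * v) (xi_family \<theta> a 0 0 0)"
    unfolding V1_def conv_field_def \<xi> vfield_sign[of _ _ _ _ l1 l2 l3] ..
  then show "\<forall>x. V1 \<alpha> v \<xi> x = 0"
    using assms by (simp add: V1_eq mean_profile_eq_0)
qed

theorem proposition4p2:
  fixes \<alpha> v\<^sub>r :: real
  assumes "\<alpha> > 0" and "v\<^sub>r > 0"
  shows
    "(\<forall>\<xi> :: real^4. (\<forall>x. V1 \<alpha> v\<^sub>r \<xi> x = 0) \<longleftrightarrow> (\<exists>\<theta> a l\<^sub>1 l\<^sub>2 l\<^sub>3. \<xi> = xi_family \<theta> a l\<^sub>1 l\<^sub>2 l\<^sub>3))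
   \<and> (\<forall>\<xi> :: real^4. (\<forall>x. V1 \<alpha> v\<^sub>r \<xi> x = 0) \<longleftrightarrow>
        (let a = \<xi>$2 - \<xi>$1; b = \<xi>$3 - \<xi>$2; c = \<xi>$4 - \<xi>$3
         in [b = pi / 2 - a] (rmod pi) \<and> [c = a - pi / 2] (rmod pi)))
   \<and> (\<forall>\<theta> \<delta> a l\<^sub>1 l\<^sub>2 l\<^sub>3 x.
        vfield \<alpha> v\<^sub>r (xi_family (\<theta> + \<delta>) a l\<^sub>1 l\<^sub>2 l\<^sub>3) x
        = vfield \<alpha> v\<^sub>r (xi_family \<theta> a l\<^sub>1 l\<^sub>2 l\<^sub>3) (x + (\<delta> / \<alpha>) *\<^sub>R vector [1, 1, 1, 1]))
   \<and> (\<forall>\<theta> a l\<^sub>1 l\<^sub>2 l\<^sub>3 x.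
        vfield \<alpha> v\<^sub>r (xi_family \<theta> a l\<^sub>1 l\<^sub>2 l\<^sub>3) x
        = ((-1) powi (l\<^sub>1 + l\<^sub>2 + l\<^sub>3)) *\<^sub>R vfield \<alpha> v\<^sub>r (xi_family \<theta> a 0 0 0) x)
   \<and> (\<forall>a \<theta> l\<^sub>1 l\<^sub>2 l\<^sub>3 \<theta>' m\<^sub>1 m\<^sub>2 m\<^sub>3. \<exists>y. \<exists>s\<in>{1, -1}. \<forall>x.
        vfield \<alpha> v\<^sub>r (xi_family \<theta> a l\<^sub>1 l\<^sub>2 l\<^sub>3) x
        = s *\<^sub>R vfield \<alpha> v\<^sub>r (xi_family \<theta>' a m\<^sub>1 m\<^sub>2 m\<^sub>3) (x + y))"
proof -
  have family: "(\<forall>x. V1 \<alpha> v\<^sub>r \<xi> x = 0) \<longleftrightarrow> (\<exists>\<theta> a l\<^sub>1 l\<^sub>2 l\<^sub>3. \<xi> = xi_family \<theta> a l\<^sub>1 l\<^sub>2 l\<^sub>3)"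
    and congruences: "(\<forall>x. V1 \<alpha> v\<^sub>r \<xi> x = 0) \<longleftrightarrow>
        (let a = \<xi>$2 - \<xi>$1; b = \<xi>$3 - \<xi>$2; c = \<xi>$4 - \<xi>$3
         in [b = pi / 2 - a] (rmod pi) \<and> [c = a - pi / 2] (rmod pi))" for \<xi>
    unfolding Let_def V1_zero_iff[OF assms] in_xi_family_iff phase_congruences_iff by (rule refl)+
  have sign: "vfield \<alpha> v\<^sub>r (xi_family \<theta> a l\<^sub>1 l\<^sub>2 l\<^sub>3) x
        = ((-1) powi (l\<^sub>1 + l\<^sub>2 + l\<^sub>3)) *\<^sub>R vfield \<alpha> v\<^sub>r (xi_family \<theta> a 0 0 0) x" for \<theta> a l\<^sub>1 l\<^sub>2 l\<^sub>3 x
    by (simp add: vfield_sign[of _ _ _ _ l\<^sub>1] vfield_scale)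
  have "\<exists>y. \<exists>s\<in>{1, -1}. \<forall>x. vfield \<alpha> v\<^sub>r (xi_family \<theta> a l\<^sub>1 l\<^sub>2 l\<^sub>3) x
        = s *\<^sub>R vfield \<alpha> v\<^sub>r (xi_family \<theta>' a m\<^sub>1 m\<^sub>2 m\<^sub>3) (x + y)" for a \<theta> l\<^sub>1 l\<^sub>2 l\<^sub>3 \<theta>' m\<^sub>1 m\<^sub>2 m\<^sub>3
  proof (intro exI bexI allI)
    fix x
    let ?s = "(-1) powi (l\<^sub>1 + l\<^sub>2 + l\<^sub>3) * (-1) powi (m\<^sub>1 + m\<^sub>2 + m\<^sub>3) :: real"
    let ?y = "((\<theta> - \<theta>') / \<alpha>) *\<^sub>R vector [1, 1, 1, 1]"
    have "vfield \<alpha> v\<^sub>r (xi_family \<theta> a l\<^sub>1 l\<^sub>2 l\<^sub>3) x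
        = ((-1) powi (l\<^sub>1 + l\<^sub>2 + l\<^sub>3)) *\<^sub>R vfield \<alpha> v\<^sub>r (xi_family \<theta>' a 0 0 0) (x + ?y)"
      using sign[of \<theta> a l\<^sub>1 l\<^sub>2 l\<^sub>3 x] vfield_translate[OF assms(1), of v\<^sub>r \<theta>' "\<theta> - \<theta>'" a 0 0 0 x]
      by (simp only: add_diff_cancel_left' diff_add_cancel add_diff_eq add.commute)
    also have "\<dots> = ?s *\<^sub>R vfield \<alpha> v\<^sub>r (xi_family \<theta>' a m\<^sub>1 m\<^sub>2 m\<^sub>3) (x + ?y)"
      unfolding sign[of \<theta>' a m\<^sub>1] by (simp add: power_int_minus_one_mult_self flip: mult.assoc)
    finally show "vfield \<alpha> v\<^sub>r (xi_family \<theta> a l\<^sub>1 l\<^sub>2 l\<^sub>3) x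
        = ?s *\<^sub>R vfield \<alpha> v\<^sub>r (xi_family \<theta>' a m\<^sub>1 m\<^sub>2 m\<^sub>3) (x + ?y)" .
    show "?s \<in> {1, -1}"
      by (auto simp: power_int_minus_left)
  qed
  then show ?thesis
    by (intro conjI allI family congruences vfield_translate[OF assms(1)] sign)
qed

end
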